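(* Let $z_1,\dots,z_J$ be distinct points of the unit circle, $\phi(z)=\prod_{j=1}^J(1-\overline{z_j}z)$, and let $(a_n)_{n\ge0}$ be a sequence of complex numbers with $a_n\ne1$ for all $n$ and $\lim_{n\to\infty}n(1-a_n)=p$, where $p>1/2$ is real. Let $H(K)$ be the reproducing kernel Hilbert space with orthonormal basis $f_n(z)=\phi(a_nz)z^n$, $n\ge0$. Then $\phi(z)H^2(\mathbb{D})\subset H(K)$, i.e. $\phi g\in H(K)$ for every $g\in H^2(\mathbb{D})$.
   Context: $J\ge1$ is an integer. $K(z,\zeta)=\sum_{n=0}^\infty f_n(z)\overline{f_n(\zeta)}$ is the kernel of $H(K)$, and $\{f_n\}_{n\ge0}$ is an orthonormal basis of $H(K)$, so its elements are the functions $f=\sum_n\alpha_nf_n$ with $(\alpha_n)\in\ell^2$ and $\|f\|=\|(\alpha_n)\|_{\ell^2}$. The elements of $H(K)$ are analytic on the open unit disc $\mathbb{D}$ and are identified with their restrictions to $\mathbb{D}$ when compared with elements of the Hardy space $H^2(\mathbb{D})$. *)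

theory Defs
  imports "HOL-Complex_Analysis.Complex_Analysis"
begin

(* Hardy space of the disc, via bounded integral means; values off the disc are irrelevant. *)
definition hardy_H2 :: "(complex \<Rightarrow> complex) set" where
  "hardy_H2 = {g. g holomorphic_on ball 0 1 \<and>
     bdd_above ((\<lambda>r. 1 / (2 * pi) *
       integral {0..2 * pi} (\<lambda>t. (cmod (g (of_real r * cis t)))\<^sup>2)) ` {0..<1})}"

(* The natural domain of K(z,w) = (\<Sum>n. f n z * cnj (f n w)): the points where K(z,z) is finite. *)
definition rk_domain :: "(nat \<Rightarrow> complex \<Rightarrow> complex) \<Rightarrow> complex set" where
  "rk_domain f = {z. summable (\<lambda>n. (cmod (f n z))\<^sup>2)}"

(* Underlying set of H(K); an element is determined by its values on rk_domain f. *)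
definition rk_space :: "(nat \<Rightarrow> complex \<Rightarrow> complex) \<Rightarrow> (complex \<Rightarrow> complex) set" where
  "rk_space f = {h. \<exists>\<alpha>. summable (\<lambda>n. (cmod (\<alpha> n))\<^sup>2) \<and>
     (\<forall>z\<in>rk_domain f. (\<lambda>n. \<alpha> n * f n z) sums h z)}"

definition circle_poly :: "nat \<Rightarrow> (nat \<Rightarrow> complex) \<Rightarrow> complex \<Rightarrow> complex" where
  "circle_poly J z w = (\<Prod>j\<in>{1..J}. 1 - cnj (z j) * w)"

definition dilated_basis :: "(complex \<Rightarrow> complex) \<Rightarrow> (nat \<Rightarrow> complex) \<Rightarrow> nat \<Rightarrow> complex \<Rightarrow> complex" where
  "dilated_basis \<phi> a n w = \<phi> (a n * w) * w ^ n"

lemma dilated_bound: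
  assumes "continuous_on UNIV \<phi>" and "Bseq a"
  shows "\<exists>B>0. \<forall>n w. cmod w < 1 \<longrightarrow> cmod (\<phi> (a n * w)) \<le> B"
proof -
  obtain R where R: "R > 0" "\<And>n. cmod (a n) \<le> R"
    using assms(2) unfolding Bseq_def by blast
  have "compact (\<phi> ` cball 0 R)"
    by (intro compact_continuous_image continuous_on_subset[OF assms(1)] compact_cball subset_UNIV)
  then have "bounded (\<phi> ` cball 0 R)"
    by (rule compact_imp_bounded)
  then obtain B where B: "B > 0" "\<forall>x \<in> \<phi> ` cball 0 R. cmod x \<le> B"
    unfolding bounded_pos by blast
  show ?thesis
  proof (intro exI[of _ B] conjI B(1) allI impI)
    fix n and w :: complex assume w: "cmod w < 1"
    have "cmod (a n) * cmod w \<le> R * 1"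
      by (rule mult_mono) (use R w in simp_all)
    then have "a n * w \<in> cball 0 R"
      by (simp add: norm_mult)
    then show "cmod (\<phi> (a n * w)) \<le> B"
      using B(2) by blast
  qed
qed

lemma ball_subset_rk_domain:
  assumes "continuous_on UNIV \<phi>" and "Bseq a"
  shows "ball 0 1 \<subseteq> rk_domain (dilated_basis \<phi> a)"
proof
  fix w :: complex assume "w \<in> ball 0 1"
  then have w: "cmod w < 1" by simp
  obtain B where B: "B > 0" "\<And>n w. cmod w < 1 \<Longrightarrow> cmod (\<phi> (a n * w)) \<le> B"
    using dilated_bound[OF assms] by blast
  have "(cmod w)\<^sup>2 < 1" using w by (simp add: abs_square_less_1)
  then have geo: "summable (\<lambda>n. B\<^sup>2 * ((cmod w)\<^sup>2) ^ n)"
    by (intro summable_mult summable_geometric) simp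
  have le: "(cmod (dilated_basis \<phi> a n w))\<^sup>2 \<le> B\<^sup>2 * ((cmod w)\<^sup>2) ^ n" for n
  proof -
    have "(cmod (dilated_basis \<phi> a n w))\<^sup>2 = (cmod (\<phi> (a n * w)))\<^sup>2 * ((cmod w)\<^sup>2) ^ n"
      by (simp add: dilated_basis_def norm_mult norm_power power_mult_distrib flip: power_mult)
        (simp add: mult.commute)
    also have "\<dots> \<le> B\<^sup>2 * ((cmod w)\<^sup>2) ^ n"
      using B(2)[OF w] by (intro mult_right_mono power_mono) auto
    finally show ?thesis .
  qed
  show "w \<in> rk_domain (dilated_basis \<phi> a)"
    unfolding rk_domain_def mem_Collect_eq
    by (rule summable_comparison_test'[OF geo, where N = 0])
      (simp only: real_norm_def abs_power2 le)
qed

(* Coefficients are unique, so the l2-norm on coefficients is a Hilbert norm on rk_space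
   for which the functions dilated_basis \<phi> a n form an orthonormal basis. *)
lemma dilated_basis_independent:
  assumes \<phi>: "continuous_on UNIV \<phi>" "\<phi> 0 \<noteq> 0" and "Bseq a"
    and \<alpha>: "summable (\<lambda>n. (cmod (\<alpha> n))\<^sup>2)"
    and zero: "\<And>w. w \<in> ball 0 1 \<Longrightarrow> (\<lambda>n. \<alpha> n * dilated_basis \<phi> a n w) sums 0"
  shows "\<alpha> m = 0"
proof (induction m rule: less_induct)
  case (less m)
  obtain B where B: "B > 0" "\<And>n w. cmod w < 1 \<Longrightarrow> cmod (\<phi> (a n * w)) \<le> B"
    using dilated_bound[OF \<phi>(1) \<open>Bseq a\<close>] by blast
  have "(\<lambda>n. sqrt ((cmod (\<alpha> n))\<^sup>2)) \<longlonglongrightarrow> sqrt 0"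
    using summable_LIMSEQ_zero[OF \<alpha>] by (rule tendsto_real_sqrt)
  then have "\<alpha> \<longlonglongrightarrow> 0" by (simp add: tendsto_norm_zero_iff)
  then have "Bseq \<alpha>" by (intro convergent_imp_Bseq convergentI)
  then obtain A where A: "A > 0" "\<And>n. cmod (\<alpha> n) \<le> A" unfolding Bseq_def by blast
  have bound: "cmod (\<alpha> m * \<phi> (a m * w)) \<le> cmod w * (2 * A * B)"
    if w: "w \<noteq> 0" "cmod w < 1/2" for w
  proof -
    let ?c = "\<lambda>n. \<alpha> n * \<phi> (a n * w)"
    have "(\<lambda>n. ?c n * w ^ n) sums 0"
      using zero[of w] w by (simp add: dilated_basis_def mult.assoc)
    then have "(\<lambda>n. ?c (n + m) * w ^ (n + m)) sums (0 - (\<Sum>i<m. ?c i * w ^ i))"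
      by (rule sums_split_initial_segment)
    moreover have "(\<Sum>i<m. ?c i * w ^ i) = 0"
      by (intro sum.neutral) (simp add: less.IH)
    ultimately have "(\<lambda>n. inverse (w ^ m) * (?c (n + m) * w ^ (n + m))) sums (inverse (w ^ m) * 0)"
      by (intro sums_mult) simp
    moreover have "inverse (w ^ m) * (x * w ^ (n + m)) = x * w ^ n" for x n
      using w(1) by (simp add: power_add)
    ultimately have "(\<lambda>n. ?c (n + m) * w ^ n) sums 0" by simp
    from sums_split_initial_segment[OF this, of 1]
    have s: "(\<lambda>n. ?c (Suc n + m) * w ^ Suc n) sums (- ?c m)" by simp
    have b: "cmod (?c (Suc n + m) * w ^ Suc n) \<le> (A * B * cmod w) * (1/2) ^ n" for n
    proof -
      have "cmod (?c (Suc n + m) * w ^ Suc n)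
          = (cmod (\<alpha> (Suc n + m)) * cmod (\<phi> (a (Suc n + m) * w))) * (cmod w * cmod w ^ n)"
        by (simp add: norm_mult norm_power)
      also have "\<dots> \<le> (A * B) * (cmod w * (1/2) ^ n)"
        using A B(1) B(2)[of w] w by (intro mult_mono power_mono) auto
      finally show ?thesis by (simp add: mult_ac)
    qed
    have g: "(\<lambda>n. (A * B * cmod w) * (1/2) ^ n) sums ((A * B * cmod w) * 2)"
      using geometric_sums[of "1/2::real"] by (intro sums_mult) simp
    have "cmod (\<Sum>n. ?c (Suc n + m) * w ^ Suc n) \<le> (\<Sum>n. (A * B * cmod w) * (1/2) ^ n)"
      using b sums_summable[OF g] by (rule norm_suminf_le)
    also have "\<dots> = cmod w * (2 * A * B)"
      unfolding sums_unique[OF g, symmetric] by simp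
    finally show ?thesis
      unfolding sums_unique[OF s, symmetric] by simp
  qed
  have "continuous_on UNIV (\<lambda>w. \<phi> (a m * w))"
    by (intro continuous_on_compose2[OF \<phi>(1)] continuous_on_mult continuous_on_const
        continuous_on_id subset_UNIV)
  then have "((\<lambda>w. \<phi> (a m * w)) \<longlongrightarrow> \<phi> (a m * 0)) (at 0)"
    unfolding continuous_on_def by blast
  then have l: "((\<lambda>w. cmod (\<alpha> m * \<phi> (a m * w))) \<longlongrightarrow> cmod (\<alpha> m * \<phi> 0)) (at 0)"
    by (intro tendsto_intros) simp
  have r: "((\<lambda>w::complex. cmod w * (2 * A * B)) \<longlongrightarrow> cmod 0 * (2 * A * B)) (at 0)"
    by (intro tendsto_intros)
  have "eventually (\<lambda>w. cmod (\<alpha> m * \<phi> (a m * w)) \<le> cmod w * (2 * A * B)) (at 0)"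
    unfolding eventually_at using bound by (intro exI[of _ "1/2"]) (auto simp: dist_norm)
  then have "cmod (\<alpha> m * \<phi> 0) \<le> cmod 0 * (2 * A * B)"
    using tendsto_le[OF _ r l] by simp
  then show ?case using \<phi>(2) by simp
qed

end

theory Submission
  imports Defs
begin

text \<open>
  Write \<open>\<phi>(w) = \<Sum>k. c\<^sub>k w\<^sup>k\<close> and let \<open>g\<close> have Taylor coefficients \<open>g\<^sub>n\<close>; they are square-summable because
  \<open>g\<close> lies in the Hardy space (\<open>hardy_H2_coeffs\<close>). Comparing coefficients, \<open>\<Sum>n. \<alpha>\<^sub>n \<phi>(a\<^sub>n w) w\<^sup>n = \<phi>(w) g(w)\<close>
  says that \<open>\<Sum>k. c\<^sub>k a\<^bsub>m-k\<^esub>\<^sup>k \<alpha>\<^bsub>m-k\<^esub> = \<Sum>k. c\<^sub>k g\<^bsub>m-k\<^esub>\<close> for every \<open>m\<close>. As \<open>c\<^sub>0 = 1\<close>, this triangular system has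
  a solution \<open>\<alpha>\<close>, and the whole problem is to show that \<open>\<alpha>\<close> is square-summable. The difference
  \<open>\<beta> = \<alpha> - g\<close> satisfies the same recurrence with right-hand side
  \<open>r\<^sub>m = \<Sum>k. c\<^sub>k (1 - a\<^bsub>m-k\<^esub>\<^sup>k) g\<^bsub>m-k\<^esub>\<close>, for which \<open>m r\<^sub>m\<close> is square-summable, since \<open>1 - a\<^sub>n\<^sup>k\<close> is of order
  \<open>1/n\<close>.

  The recurrence is diagonalised as follows (\<open>perturbed_recurrence_summable\<close>). Let \<open>J\<close> be the number of
  zeros \<open>z\<^sub>j\<close> of \<open>\<phi>\<close>, let \<open>\<zeta>\<^sub>j\<close> be the conjugate of \<open>z\<^sub>j\<close>, let
  \<open>P\<^sub>j(w) = \<phi>(w) / (1 - \<zeta>\<^sub>j w) = \<Sum>k. d\<^bsub>jk\<^esub> w\<^sup>k\<close>, and put \<open>u\<^sub>j(n) = \<Sum>k<J. d\<^bsub>jk\<^esub> a\<^sub>n\<^sup>k \<beta>\<^bsub>n-k\<^esub>\<close>. If \<open>a\<close> were constant,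
  \<open>(1 - \<zeta>\<^sub>j a w) P\<^sub>j(a w) = \<phi>(a w)\<close> would give exactly \<open>u\<^sub>j(n+1) = \<zeta>\<^sub>j a u\<^sub>j(n) + r\<^bsub>n+1\<^esub>\<close>. In fact
  \<open>a\<^sub>n\<^sup>k - a\<^bsub>n-i\<^esub>\<^sup>k = o(1/n)\<close>, because both powers equal \<open>1 - kp/n + o(1/n)\<close>, so the equation holds up to an
  error \<open>o(1/n)\<close> times the neighbouring values of \<open>\<beta>\<close>. Since the \<open>z\<^sub>j\<close> are distinct, Lagrange interpolation
  expresses those values through the \<open>u\<^sub>j(n)\<close>. As \<open>|\<zeta>\<^sub>j| = 1\<close> and \<open>|a\<^sub>n| = 1 - p/n + o(1/n)\<close>, the sum
  \<open>U(n) = \<Sum>j. |u\<^sub>j(n)|\<close> satisfies, for any \<open>q < p\<close> and large \<open>n\<close>,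
  \<open>U(n+1) \<le> (1 - q/(n+1)) U(n) + G\<^bsub>n+1\<^esub>/(n+1)\<close> with \<open>G\<close> square-summable.
  Choosing \<open>q > 1/2\<close>, a discrete Hardy inequality (\<open>contracting_recursion_square_summable\<close>) shows that
  \<open>U\<close>, hence \<open>\<beta>\<close> and \<open>\<alpha>\<close>, is square-summable.
\<close>

section \<open>Square-summable sequences\<close>

lemma summable_square_mono:
  fixes f g :: "nat \<Rightarrow> real"
  assumes "summable (\<lambda>n. (g n)\<^sup>2)" and "\<And>n. n \<ge> N \<Longrightarrow> \<bar>f n\<bar> \<le> \<bar>C * g n\<bar>"
  shows "summable (\<lambda>n. (f n)\<^sup>2)"
proof (rule summable_comparison_test')
  show "summable (\<lambda>n. C\<^sup>2 * (g n)\<^sup>2)"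
    by (intro summable_mult assms)
  show "norm ((f n)\<^sup>2) \<le> C\<^sup>2 * (g n)\<^sup>2" if "n \<ge> N" for n
    using assms(2)[OF that] by (simp add: abs_le_square_iff power_mult_distrib)
qed

lemma summable_square_add:
  fixes f g :: "nat \<Rightarrow> real"
  assumes "summable (\<lambda>n. (f n)\<^sup>2)" and "summable (\<lambda>n. (g n)\<^sup>2)"
  shows "summable (\<lambda>n. (f n + g n)\<^sup>2)"
proof (rule summable_comparison_test')
  show "summable (\<lambda>n. 2 * (f n)\<^sup>2 + 2 * (g n)\<^sup>2)"
    by (intro summable_add summable_mult assms)
  show "norm ((f n + g n)\<^sup>2) \<le> 2 * (f n)\<^sup>2 + 2 * (g n)\<^sup>2" if "n \<ge> 0" for n
  proof -
    have "(f n + g n)\<^sup>2 \<le> 2 * (f n)\<^sup>2 + 2 * (g n)\<^sup>2"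
      using sum_squares_bound[of "f n" "g n"] unfolding power2_sum by linarith
    then show ?thesis by simp
  qed
qed

lemma summable_square_sum:
  fixes f :: "'i \<Rightarrow> nat \<Rightarrow> real"
  assumes "\<And>i. i \<in> A \<Longrightarrow> summable (\<lambda>n. (f i n)\<^sup>2)"
  shows "summable (\<lambda>n. (\<Sum>i\<in>A. f i n)\<^sup>2)"
  using assms
  by (induction A rule: infinite_finite_induct) (auto intro!: summable_square_add)

lemma summable_mult_of_summable_squares:
  fixes f g :: "nat \<Rightarrow> complex"
  assumes "summable (\<lambda>n. (cmod (f n))\<^sup>2)" and "summable (\<lambda>n. (cmod (g n))\<^sup>2)"
  shows "summable (\<lambda>n. f n * g n)"
proof (rule summable_comparison_test')
  show "summable (\<lambda>n. (cmod (f n))\<^sup>2 + (cmod (g n))\<^sup>2)"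
    by (intro summable_add assms)
  show "norm (f n * g n) \<le> (cmod (f n))\<^sup>2 + (cmod (g n))\<^sup>2" if "n \<ge> 0" for n
    using sum_squares_bound[of "cmod (f n)" "cmod (g n)"]
      mult_nonneg_nonneg[OF norm_ge_zero[of "f n"] norm_ge_zero[of "g n"]]
    unfolding norm_mult by linarith
qed

text \<open>
  Expanding the square, the coefficient of \<open>x\<^sup>2\<close> is \<open>M - 2 q + q\<^sup>2 / M\<close>. Because \<open>2 q > 1\<close>, it is smaller than
  \<open>M - 1\<close> by about \<open>2 q - 1 = 2 \<eta>\<close>; half of this gain pays for \<open>q\<^sup>2 / M\<close> and for the mixed term.
\<close>

lemma weighted_square_step:
  fixes x y q M :: real
  assumes x: "x \<ge> 0" and y: "y \<ge> 0" and q: "q > 1/2"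
    and M: "M \<ge> q" "M > 0" "4 * q\<^sup>2 \<le> (2 * q - 1) * M"
  defines "\<eta> \<equiv> (2 * q - 1) / 2"
  shows "M * ((1 - q / M) * x + y / M)\<^sup>2 \<le> (M - 1) * x\<^sup>2 - \<eta> * x\<^sup>2 + (4 / \<eta> + 1 / M) * y\<^sup>2"
proof -
  have \<eta>: "\<eta> > 0" using q by (simp add: \<eta>_def)
  have "M * ((1 - q / M) * x + y / M)\<^sup>2
      = (M - 2 * q + q\<^sup>2 / M) * x\<^sup>2 + (1 - q / M) * (2 * x * y) + (1 / M) * y\<^sup>2"
    using M by (simp add: field_simps power2_eq_square)
  moreover have "(1 - q / M) * (2 * x * y) \<le> 1 * (2 * x * y)"
    using x y q M by (intro mult_right_mono) auto
  moreover have "2 * x * y \<le> (\<eta> / 4) * x\<^sup>2 + (4 / \<eta>) * y\<^sup>2"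
  proof -
    have "(\<eta> / 4) * x\<^sup>2 + (4 / \<eta>) * y\<^sup>2 - 2 * x * y = (\<eta> / 4) * (x - (4 / \<eta>) * y)\<^sup>2"
      using \<eta> by (simp add: field_simps power2_eq_square)
    also have "\<dots> \<ge> 0" using \<eta> by simp
    finally show ?thesis by linarith
  qed
  moreover have "(M - 2 * q + q\<^sup>2 / M) * x\<^sup>2 \<le> (M - 1 - 2 * \<eta> + \<eta> / 2) * x\<^sup>2"
  proof (rule mult_right_mono)
    have "q\<^sup>2 / M \<le> \<eta> / 2" using M by (simp add: \<eta>_def field_simps)
    then show "M - 2 * q + q\<^sup>2 / M \<le> M - 1 - 2 * \<eta> + \<eta> / 2"
      by (simp add: \<eta>_def field_simps)
  qed simp
  ultimately have "M * ((1 - q / M) * x + y / M)\<^sup>2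
      \<le> (M - 1 - 2 * \<eta> + \<eta> / 2) * x\<^sup>2 + ((\<eta> / 4) * x\<^sup>2 + (4 / \<eta>) * y\<^sup>2) + (1 / M) * y\<^sup>2"
    by linarith
  also have "\<dots> = (M - 1) * x\<^sup>2 - \<eta> * x\<^sup>2 + (4 / \<eta> + 1 / M) * y\<^sup>2 - (\<eta> / 4) * x\<^sup>2"
    by (simp add: algebra_simps)
  also have "\<dots> \<le> (M - 1) * x\<^sup>2 - \<eta> * x\<^sup>2 + (4 / \<eta> + 1 / M) * y\<^sup>2"
    using \<eta> by simp
  finally show ?thesis .
qed

text \<open>
  A discrete form of Hardy's inequality: when equality holds, \<open>b n\<close> is for large \<open>n\<close> comparable to the mean
  \<open>n powr (- q) * (\<Sum>i\<le>n. i powr (q - 1) * G i)\<close> plus a multiple of \<open>n powr (- q)\<close>. That averaging is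
  bounded on square-summable sequences exactly for \<open>q > 1 / 2\<close>. The proof follows the weighted energy \<open>n * (b n)\<^sup>2\<close>: by the previous
  lemma each step lowers it by \<open>\<eta> * (b n)\<^sup>2\<close>, up to a multiple of \<open>(G (Suc n))\<^sup>2\<close>, so telescoping bounds the
  sum of the squares.
\<close>

lemma contracting_recursion_square_summable:
  fixes b G :: "nat \<Rightarrow> real" and q :: real
  assumes q: "q > 1 / 2"
    and b: "\<And>n. b n \<ge> 0" and G: "\<And>n. G n \<ge> 0" "summable (\<lambda>n. (G n)\<^sup>2)"
    and rec: "eventually (\<lambda>n. b (Suc n) \<le> (1 - q / Suc n) * b n + G (Suc n) / Suc n) sequentially"
  shows "summable (\<lambda>n. (b n)\<^sup>2)"
proof -
  define \<eta> where "\<eta> = (2 * q - 1) / 2"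
  have \<eta>: "\<eta> > 0" using q by (simp add: \<eta>_def)
  define C where "C = 4 / \<eta> + 1"
  have C: "C \<ge> 0" using \<eta> by (simp add: C_def)
  have "eventually (\<lambda>n. real n \<ge> max q (4 * q\<^sup>2 / (2 * q - 1))) sequentially"
    using filterlim_real_sequentially unfolding filterlim_at_top by blast
  with rec have "eventually (\<lambda>n. b (Suc n) \<le> (1 - q / Suc n) * b n + G (Suc n) / Suc n \<and>
      real n \<ge> max q (4 * q\<^sup>2 / (2 * q - 1))) sequentially"
    by (rule eventually_conj)
  then obtain N where N: "\<And>n. n \<ge> N \<Longrightarrow> b (Suc n) \<le> (1 - q / Suc n) * b n + G (Suc n) / Suc n"
     "\<And>n. n \<ge> N \<Longrightarrow> real n \<ge> max q (4 * q\<^sup>2 / (2 * q - 1))"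
    unfolding eventually_sequentially by blast
  have step: "\<eta> * (b n)\<^sup>2 + Suc n * (b (Suc n))\<^sup>2 \<le> n * (b n)\<^sup>2 + C * (G (Suc n))\<^sup>2" if n: "n \<ge> N" for n
  proof -
    have M: "real (Suc n) \<ge> q" "4 * q\<^sup>2 \<le> (2 * q - 1) * real (Suc n)"
    proof -
      show "real (Suc n) \<ge> q" using N(2)[OF n] by simp
      have "4 * q\<^sup>2 / (2 * q - 1) \<le> real (Suc n)" using N(2)[OF n] by simp
      then show "4 * q\<^sup>2 \<le> (2 * q - 1) * real (Suc n)"
        using q by (simp add: divide_le_eq mult.commute)
    qed
    have "Suc n * (b (Suc n))\<^sup>2 \<le> Suc n * ((1 - q / Suc n) * b n + G (Suc n) / Suc n)\<^sup>2"
      by (intro mult_left_mono power_mono N(1) n b) auto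
    also have "\<dots> \<le> (real (Suc n) - 1) * (b n)\<^sup>2 - \<eta> * (b n)\<^sup>2 + (4 / \<eta> + 1 / Suc n) * (G (Suc n))\<^sup>2"
      unfolding \<eta>_def by (rule weighted_square_step) (use b G q M in auto)
    also have "(4 / \<eta> + 1 / Suc n) * (G (Suc n))\<^sup>2 \<le> C * (G (Suc n))\<^sup>2"
      unfolding C_def by (intro mult_right_mono add_left_mono) auto
    finally show ?thesis by (simp add: algebra_simps)
  qed
  have G': "summable (\<lambda>i. C * (G (Suc (i + N)))\<^sup>2)"
    using summable_ignore_initial_segment[OF G(2), of "Suc N"] by (intro summable_mult) simp
  have tele: "(\<Sum>i<n. \<eta> * (b (i + N))\<^sup>2) + real (n + N) * (b (n + N))\<^sup>2
      \<le> N * (b N)\<^sup>2 + (\<Sum>i<n. C * (G (Suc (i + N)))\<^sup>2)" for n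
  proof (induction n)
    case (Suc n)
    then show ?case using step[of "n + N"] by simp
  qed simp
  have "summable (\<lambda>i. \<eta> * (b (i + N))\<^sup>2)"
  proof (rule summableI_nonneg_bounded)
    fix n
    have "(\<Sum>i<n. \<eta> * (b (i + N))\<^sup>2) \<le> (\<Sum>i<n. \<eta> * (b (i + N))\<^sup>2) + real (n + N) * (b (n + N))\<^sup>2"
      by simp
    also note tele
    also have "(\<Sum>i<n. C * (G (Suc (i + N)))\<^sup>2) \<le> (\<Sum>i. C * (G (Suc (i + N)))\<^sup>2)"
      using C by (intro sum_le_suminf G') auto
    finally show "(\<Sum>i<n. \<eta> * (b (i + N))\<^sup>2) \<le> N * (b N)\<^sup>2 + (\<Sum>i. C * (G (Suc (i + N)))\<^sup>2)"
      by simp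
  qed (use \<eta> in simp)
  then have "summable (\<lambda>i. (b (i + N))\<^sup>2)"
    by (rule summable_mult_D) (use \<eta> in simp)
  then show ?thesis
    using summable_iff_shift[of "\<lambda>n. (b n)\<^sup>2" N] by blast
qed

section \<open>Taylor coefficients of Hardy space functions\<close>

lemma has_integral_cis_period:
  fixes k :: int
  shows "((\<lambda>t. cis (of_int k * t)) has_integral (if k = 0 then 2 * of_real pi else 0)) {0..2 * pi}"
proof (cases "k = 0")
  case True
  then show ?thesis
    using has_integral_const_real[of "1::complex" 0 "2 * pi"] by (simp add: scaleR_conv_of_real)
next
  case False
  have "((\<lambda>t. cis (of_int k * t)) has_integral
      (cis (of_int k * (2 * pi)) / (\<i> * of_int k) - cis (of_int k * 0) / (\<i> * of_int k))) {0..2 * pi}"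
  proof (rule fundamental_theorem_of_calculus)
    fix t :: real
    show "((\<lambda>t. cis (of_int k * t) / (\<i> * of_int k)) has_vector_derivative cis (of_int k * t))
        (at t within {0..2 * pi})"
      unfolding cis_conv_exp of_real_mult
      by (rule has_vector_derivative_real_field)
        (use False in \<open>auto intro!: derivative_eq_intros simp: mult_ac\<close>)
  qed simp
  moreover have "cis (of_int k * (2 * pi)) = 1"
    using cis_multiple_2pi[of "of_int k"] by (simp add: mult_ac)
  ultimately show ?thesis using False by simp
qed

lemma trig_poly_parseval:
  fixes c :: "nat \<Rightarrow> complex"
  shows "((\<lambda>t. (cmod (\<Sum>n<M. c n * cis t ^ n))\<^sup>2) has_integral (2 * pi * (\<Sum>n<M. (cmod (c n))\<^sup>2))) {0..2 * pi}"
proof -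
  have expand: "Re (\<Sum>n<M. \<Sum>m<M. c n * cnj (c m) * cis (of_int (int n - int m) * t))
      = (cmod (\<Sum>n<M. c n * cis t ^ n))\<^sup>2" for t
  proof -
    have "(\<Sum>n<M. \<Sum>m<M. c n * cnj (c m) * cis (of_int (int n - int m) * t))
        = (\<Sum>n<M. c n * cis t ^ n) * cnj (\<Sum>n<M. c n * cis t ^ n)"
      unfolding cnj_sum sum_product
      by (intro sum.cong refl)
        (simp add: Complex.DeMoivre cis_cnj cis_mult algebra_simps)
    also have "\<dots> = of_real ((cmod (\<Sum>n<M. c n * cis t ^ n))\<^sup>2)"
      by (simp only: complex_norm_square)
    finally show ?thesis
      by (simp only: Re_complex_of_real)
  qed
  have "((\<lambda>t. \<Sum>n<M. \<Sum>m<M. c n * cnj (c m) * cis (of_int (int n - int m) * t)) has_integral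
      (\<Sum>n<M. \<Sum>m<M. c n * cnj (c m) * (if int n - int m = 0 then 2 * of_real pi else 0))) {0..2 * pi}"
    by (intro has_integral_sum has_integral_mult_right has_integral_cis_period) auto
  moreover have "(\<Sum>n<M. \<Sum>m<M. c n * cnj (c m) * (if int n - int m = 0 then 2 * of_real pi else 0))
      = (\<Sum>n<M. c n * cnj (c n) * (2 * of_real pi))"
    by (simp add: if_distrib[of "\<lambda>x. _ * x"] cong: if_cong)
  moreover have "\<dots> = of_real (2 * pi * (\<Sum>n<M. (cmod (c n))\<^sup>2))"
    by (simp add: sum_distrib_left mult_ac flip: complex_norm_square)
  ultimately have "((\<lambda>t. \<Sum>n<M. \<Sum>m<M. c n * cnj (c m) * cis (of_int (int n - int m) * t)) has_integral
      of_real (2 * pi * (\<Sum>n<M. (cmod (c n))\<^sup>2))) {0..2 * pi}"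
    by simp
  from has_integral_Re[OF this] show ?thesis
    unfolding expand by simp
qed

text \<open>
  On a circle of radius \<open>r < 1\<close> the Taylor polynomials converge uniformly, so Parseval's identity for them
  bounds \<open>\<Sum>n<N. (cmod (c n) * r ^ n)\<^sup>2\<close> by the mean of \<open>(cmod g)\<^sup>2\<close> on that circle. These means have a common
  bound, and \<open>r\<close> tends to 1 for fixed \<open>N\<close>.
\<close>

lemma hardy_H2_coeffs:
  assumes "g \<in> hardy_H2"
  obtains c where "summable (\<lambda>n. (cmod (c n))\<^sup>2)"
    and "\<And>w. w \<in> ball 0 1 \<Longrightarrow> (\<lambda>n. c n * w ^ n) sums g w"
proof -
  have hol: "g holomorphic_on ball 0 1"
    using assms by (simp add: hardy_H2_def)
  obtain B where B: "\<And>r. r \<in> {0..<1} \<Longrightarrow>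
      1 / (2 * pi) * integral {0..2 * pi} (\<lambda>t. (cmod (g (of_real r * cis t)))\<^sup>2) \<le> B"
    using assms unfolding hardy_H2_def bdd_above_def by blast
  define c where "c n = (deriv ^^ n) g 0 / fact n" for n
  have c: "(\<lambda>n. c n * w ^ n) sums g w" if "w \<in> ball 0 1" for w
    using holomorphic_power_series[OF hol that] by (simp add: c_def)
  have bound: "(\<Sum>n<N. (cmod (c n) * r ^ n)\<^sup>2) \<le> B" if r: "r \<in> {0..<1}" for r :: real and N
  proof -
    let ?S = "\<lambda>M t. \<Sum>n<M. c n * (of_real r * cis t) ^ n"
    let ?D = "\<lambda>M t. (cmod (?S M t))\<^sup>2"
    have rc: "of_real r * cis t \<in> ball 0 1" for t
      using r by (simp add: norm_mult)
    \<comment> \<open>A radius strictly between \<open>r\<close> and 1: convergence there gives absolute convergence at \<open>r\<close>.\<close>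
    define s where "s = (r + 1) / 2"
    have s: "0 < s" "s < 1" "r < s" using r by (auto simp: s_def)
    have "summable (\<lambda>n. c n * of_real s ^ n)"
      using c[of "of_real s"] s by (auto simp: sums_iff)
    then have abs: "summable (\<lambda>n. cmod (c n * of_real r ^ n))"
      by (rule powser_insidea) (use r s in auto)
    have "uniform_limit {0..2*pi} ?S (\<lambda>t. \<Sum>n. c n * (of_real r * cis t) ^ n) sequentially"
      by (rule Weierstrass_m_test[OF _ abs]) (simp add: norm_mult norm_power)
    moreover have "(\<Sum>n. c n * (of_real r * cis t) ^ n) = g (of_real r * cis t)" for t
      using c[OF rc[of t]] by (simp add: sums_iff)
    ultimately have ul: "uniform_limit {0..2*pi} ?S (\<lambda>t. g (of_real r * cis t)) sequentially"
      by simp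
    have cont: "continuous_on {0..2*pi} (\<lambda>t. g (of_real r * cis t))"
      by (rule continuous_on_compose2[OF holomorphic_on_imp_continuous_on[OF hol]])
        (use rc in \<open>auto intro!: continuous_intros\<close>)
    then have bd: "bounded ((\<lambda>t. g (of_real r * cis t)) ` {0..2*pi})"
      by (intro compact_imp_bounded compact_continuous_image) auto
    have bdr: "bounded ((\<lambda>t. cmod (g (of_real r * cis t))) ` {0..2*pi})"
      using bd by (auto simp: bounded_iff)
    have ul_norm: "uniform_limit {0..2*pi} (\<lambda>M t. cmod (?S M t)) (\<lambda>t. cmod (g (of_real r * cis t))) sequentially"
      using ul by (rule uniform_limit_norm)
    have ul2: "uniform_limit {0..2*pi} ?D (\<lambda>t. (cmod (g (of_real r * cis t)))\<^sup>2) sequentially"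
      unfolding power2_eq_square
      by (rule uniform_lim_mult[OF ul_norm ul_norm bdr bdr])
    have Dc: "continuous_on {0..2*pi} (?D M)" for M
      by (intro continuous_intros)
    obtain I L where IL: "\<And>M. (?D M has_integral I M) {0..2*pi}"
        "((\<lambda>t. (cmod (g (of_real r * cis t)))\<^sup>2) has_integral L) {0..2*pi}" "I \<longlonglongrightarrow> L"
      using uniform_limit_integral[OF ul2 Dc] by auto
    have I: "I M = 2 * pi * (\<Sum>n<M. (cmod (c n) * r ^ n)\<^sup>2)" for M
    proof (rule has_integral_unique[OF IL(1)])
      show "(?D M has_integral 2 * pi * (\<Sum>n<M. (cmod (c n) * r ^ n)\<^sup>2)) {0..2*pi}"
        using trig_poly_parseval[where c = "\<lambda>n. c n * of_real r ^ n" and M = M] r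
        by (simp add: norm_mult norm_power power_mult_distrib mult_ac)
    qed
    have "I N \<le> L"
    proof (rule LIMSEQ_le_const[OF IL(3)], intro exI allI impI)
      fix M assume "N \<le> M"
      then show "I N \<le> I M"
        unfolding I by (intro mult_left_mono sum_mono2) auto
    qed
    moreover have "L \<le> 2 * pi * B"
      using B[OF r] integral_unique[OF IL(2)] by (simp add: field_simps)
    ultimately have "(2 * pi) * (\<Sum>n<N. (cmod (c n) * r ^ n)\<^sup>2) \<le> (2 * pi) * B"
      unfolding I by linarith
    then show ?thesis
      by (rule mult_left_le_imp_le) simp
  qed
  have "(\<Sum>n<N. (cmod (c n))\<^sup>2) \<le> B" for N
  proof -
    have "((\<lambda>r. \<Sum>n<N. (cmod (c n) * r ^ n)\<^sup>2) \<longlongrightarrow> (\<Sum>n<N. (cmod (c n) * 1 ^ n)\<^sup>2)) (at_left (1::real))"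
      by (intro tendsto_intros)
    moreover have "eventually (\<lambda>r. (\<Sum>n<N. (cmod (c n) * r ^ n)\<^sup>2) \<le> B) (at_left (1::real))"
      unfolding eventually_at_left_field by (intro exI[of _ 0]) (auto intro!: bound)
    ultimately show ?thesis
      by (simp add: tendsto_upperbound)
  qed
  then have "summable (\<lambda>n. (cmod (c n))\<^sup>2)"
    by (intro summableI_nonneg_bounded) auto
  with c show thesis using that by blast
qed

section \<open>Polynomials with prescribed reciprocal roots\<close>

definition recip_root_poly :: "'i set \<Rightarrow> ('i \<Rightarrow> complex) \<Rightarrow> complex poly" where
  "recip_root_poly I \<zeta> = (\<Prod>i\<in>I. [:1, - \<zeta> i:])"

lemma poly_recip_root_poly: "poly (recip_root_poly I \<zeta>) w = (\<Prod>i\<in>I. 1 - \<zeta> i * w)"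
  by (simp add: recip_root_poly_def poly_prod mult.commute)

lemma degree_recip_root_poly_le: "degree (recip_root_poly I \<zeta>) \<le> card I"
proof (cases "finite I")
  case True
  have "degree (recip_root_poly I \<zeta>) \<le> sum (degree \<circ> (\<lambda>i. [:1, - \<zeta> i:])) I"
    unfolding recip_root_poly_def by (rule degree_prod_sum_le[OF True])
  also have "\<dots> \<le> sum (\<lambda>_. 1) I"
    by (intro sum_mono) auto
  finally show ?thesis by simp
qed (simp add: recip_root_poly_def)

lemma coeff_0_recip_root_poly: "coeff (recip_root_poly I \<zeta>) 0 = 1"
  by (simp add: poly_recip_root_poly flip: poly_0_coeff_0)

lemma recip_root_poly_remove:
  assumes "finite I" "j \<in> I"
  shows "recip_root_poly I \<zeta> = [:1, - \<zeta> j:] * recip_root_poly (I - {j}) \<zeta>"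
  unfolding recip_root_poly_def by (rule prod.remove[OF assms])

text \<open>
  For \<open>y k = a ^ k * \<beta> (n + 1 - k)\<close> this is the factorisation of the difference operator with symbol
  \<open>(1 - \<zeta> w) P(w)\<close> into a first-order step applied to the operator with symbol \<open>P\<close>.
\<close>

lemma sum_coeff_linear_factor_mult:
  fixes P :: "complex poly"
  assumes "degree P < J"
  shows "(\<Sum>k\<le>J. coeff ([:1, - \<zeta>:] * P) k * y k)
    = (\<Sum>k<J. coeff P k * y k) - \<zeta> * (\<Sum>k<J. coeff P k * y (Suc k))"
proof -
  have "coeff ([:1, - \<zeta>:] * P) k = coeff P k - \<zeta> * coeff (pCons 0 P) k" for k
    by (cases k) simp_all
  then have "(\<Sum>k\<le>J. coeff ([:1, - \<zeta>:] * P) k * y k)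
      = (\<Sum>k\<le>J. coeff P k * y k) - \<zeta> * (\<Sum>k\<le>J. coeff (pCons 0 P) k * y k)"
    by (simp only: left_diff_distrib sum_subtractf sum_distrib_left mult.assoc)
  moreover have "(\<Sum>k\<le>J. coeff (pCons 0 P) k * y k) = (\<Sum>k<J. coeff P k * y (Suc k))"
    by (simp add: sum.atMost_shift)
  moreover have "(\<Sum>k\<le>J. coeff P k * y k) = (\<Sum>k<J. coeff P k * y k)"
    using assms by (simp add: coeff_eq_0 flip: lessThan_Suc_atMost)
  ultimately show ?thesis by simp
qed

text \<open>
  Lagrange interpolation at the distinct roots \<open>inverse (\<zeta> j)\<close>: the polynomial with index \<open>j\<close> vanishes at all of
  them but the \<open>j\<close>-th. Both sides have degree below the number of roots and agree at each root.
\<close>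

lemma lagrange_recip_root_poly:
  fixes \<zeta> :: "'i \<Rightarrow> complex"
  assumes fin: "finite I" and inj: "inj_on \<zeta> I" and nz: "\<And>j. j \<in> I \<Longrightarrow> \<zeta> j \<noteq> 0"
    and k: "k < card I"
  shows "monom 1 k = (\<Sum>j\<in>I. smult (inverse (\<zeta> j) ^ k / poly (recip_root_poly (I - {j}) \<zeta>) (inverse (\<zeta> j)))
      (recip_root_poly (I - {j}) \<zeta>))"
    (is "_ = (\<Sum>j\<in>I. smult (?l j) (?P j))")
proof (rule poly_eqI_degree[where A = "(\<lambda>j. inverse (\<zeta> j)) ` I"])
  have "inj_on (\<lambda>j. inverse (\<zeta> j)) I"
    using inj by (auto simp: inj_on_def)
  then have card: "card ((\<lambda>j. inverse (\<zeta> j)) ` I) = card I"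
    by (rule card_image)
  show "degree (monom (1::complex) k) < card ((\<lambda>j. inverse (\<zeta> j)) ` I)"
    using k by (simp add: card degree_monom_eq)
  have "degree (smult (?l j) (?P j)) \<le> card I - 1" if "j \<in> I" for j
    using degree_smult_le[of "?l j" "?P j"] degree_recip_root_poly_le[of "I - {j}" \<zeta>] that fin
    by (simp add: card_Diff_singleton)
  then have "degree (\<Sum>j\<in>I. smult (?l j) (?P j)) \<le> card I - 1"
    by (intro degree_sum_le fin)
  then show "degree (\<Sum>j\<in>I. smult (?l j) (?P j)) < card ((\<lambda>j. inverse (\<zeta> j)) ` I)"
    using k by (simp add: card)
next
  fix x assume "x \<in> (\<lambda>j. inverse (\<zeta> j)) ` I"
  then obtain i where i: "i \<in> I" "x = inverse (\<zeta> i)" by blast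
  have ne: "poly (?P i) (inverse (\<zeta> i)) \<noteq> 0"
  proof
    assume "poly (?P i) (inverse (\<zeta> i)) = 0"
    then obtain j where j: "j \<in> I" "j \<noteq> i" "1 - \<zeta> j * inverse (\<zeta> i) = 0"
      using fin by (auto simp: poly_recip_root_poly)
    then have "\<zeta> j = \<zeta> i" using nz[OF i(1)] by (simp add: field_simps)
    then show False using inj i j by (auto simp: inj_on_def)
  qed
  have "poly (?P j) x = 0" if "j \<in> I - {i}" for j
  proof -
    have "(\<Prod>l\<in>I - {j}. 1 - \<zeta> l * x) = 0"
      using that i nz fin by (intro prod_zero bexI[of _ i]) auto
    then show ?thesis by (simp add: poly_recip_root_poly)
  qed
  then have "(\<Sum>j\<in>I. ?l j * poly (?P j) x) = ?l i * poly (?P i) x"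
    using i fin by (subst sum.remove[of _ i]) (auto intro!: sum.neutral)
  also have "\<dots> = x ^ k" using ne i by simp
  finally show "poly (monom 1 k) x = poly (\<Sum>j\<in>I. smult (?l j) (?P j)) x"
    by (simp add: poly_sum poly_monom)
qed

section \<open>Sequences approaching 1 at rate p/n\<close>

lemma tendsto_1_of_rate:
  fixes a :: "nat \<Rightarrow> complex"
  assumes "(\<lambda>n. of_nat n * (1 - a n)) \<longlonglongrightarrow> p"
  shows "a \<longlonglongrightarrow> 1"
proof -
  have "(\<lambda>n. 1 - inverse (of_nat n) * (of_nat n * (1 - a n))) \<longlonglongrightarrow> 1 - 0 * p"
    by (intro tendsto_intros assms lim_inverse_n)
  moreover have "eventually (\<lambda>n. 1 - inverse (of_nat n) * (of_nat n * (1 - a n)) = a n) sequentially"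
    using eventually_gt_at_top[of 0] by eventually_elim (simp add: field_simps)
  ultimately show ?thesis
    by (simp add: tendsto_cong)
qed

lemma rate_power:
  fixes a :: "nat \<Rightarrow> complex"
  assumes "(\<lambda>n. of_nat n * (1 - a n)) \<longlonglongrightarrow> p"
  shows "(\<lambda>n. of_nat n * (1 - a n ^ k)) \<longlonglongrightarrow> of_nat k * p"
proof -
  have "(\<lambda>n. (of_nat n * (1 - a n)) * (\<Sum>i<k. a n ^ i)) \<longlonglongrightarrow> p * (\<Sum>i<k. 1 ^ i)"
    by (intro tendsto_mult[OF assms] tendsto_sum tendsto_power tendsto_1_of_rate[OF assms])
  then show ?thesis
    by (simp add: one_diff_power_eq mult_ac)
qed

lemma rate_power_shift:
  fixes a :: "nat \<Rightarrow> complex"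
  assumes "(\<lambda>n. of_nat n * (1 - a n)) \<longlonglongrightarrow> p"
  shows "(\<lambda>n. of_nat n * (1 - a (n - i) ^ k)) \<longlonglongrightarrow> of_nat k * p"
proof (rule LIMSEQ_offset[where k = i])
  have "(\<lambda>n. of_nat n * (1 - a n ^ k) + of_nat i * (1 - a n ^ k)) \<longlonglongrightarrow> of_nat k * p + of_nat i * (1 - 1 ^ k)"
    by (intro tendsto_add[OF rate_power[OF assms]] tendsto_mult tendsto_diff tendsto_power
        tendsto_const tendsto_1_of_rate[OF assms])
  then show "(\<lambda>n. of_nat (n + i) * (1 - a (n + i - i) ^ k)) \<longlonglongrightarrow> of_nat k * p"
    by (simp add: algebra_simps)
qed

text \<open>
  By itself each of the two powers differs from 1 by a term of order \<open>1 / n\<close>; the leading terms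
  \<open>k * p / n\<close> cancel in the difference. This is why replacing \<open>a (n - k)\<close> by \<open>a n\<close> in the recurrence is
  harmless.
\<close>

lemma rate_power_diff:
  fixes a :: "nat \<Rightarrow> complex"
  assumes "(\<lambda>n. of_nat n * (1 - a n)) \<longlonglongrightarrow> p"
  shows "(\<lambda>n. real n * cmod (a n ^ k - a (n - i) ^ k)) \<longlonglongrightarrow> 0"
proof -
  have "(\<lambda>n. of_nat n * (1 - a (n - i) ^ k) - of_nat n * (1 - a n ^ k)) \<longlonglongrightarrow> of_nat k * p - of_nat k * p"
    by (intro tendsto_diff rate_power_shift rate_power assms)
  then have "(\<lambda>n. of_nat n * (a n ^ k - a (n - i) ^ k)) \<longlonglongrightarrow> 0"
    by (simp add: algebra_simps)
  then have "(\<lambda>n. cmod (of_nat n * (a n ^ k - a (n - i) ^ k))) \<longlonglongrightarrow> 0"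
    by (rule tendsto_norm_zero)
  then show ?thesis by (simp add: norm_mult)
qed

text \<open>
  This uses that the limit is real: up to \<open>o(1/n)\<close>, the number \<open>a n\<close> is the real number \<open>1 - p / n\<close>.
\<close>

lemma rate_norm_le:
  fixes a :: "nat \<Rightarrow> complex"
  assumes lim: "(\<lambda>n. of_nat n * (1 - a n)) \<longlonglongrightarrow> of_real p" and "q < p"
  shows "eventually (\<lambda>n. cmod (a n) \<le> 1 - q / real n) sequentially"
proof -
  have "eventually (\<lambda>n. dist (of_nat n * (1 - a n)) (of_real p) < p - q) sequentially"
    using lim \<open>q < p\<close> by (intro tendstoD) auto
  moreover have "eventually (\<lambda>n. real n \<ge> p) sequentially"
    using filterlim_real_sequentially unfolding filterlim_at_top by blast
  ultimately show ?thesis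
    using eventually_gt_at_top[of 0]
  proof eventually_elim
    case (elim n)
    have "real n * cmod (a n) = cmod (of_nat n * a n)"
      by (simp add: norm_mult)
    also have "\<dots> = cmod (of_real (real n - p) - (of_nat n * (1 - a n) - of_real p))"
      by (simp add: algebra_simps)
    also have "\<dots> \<le> cmod (of_real (real n - p)) + cmod (of_nat n * (1 - a n) - of_real p)"
      by (rule norm_triangle_ineq4)
    also have "\<dots> \<le> real n - q"
      using elim unfolding norm_of_real dist_norm by linarith
    finally show ?case
      using elim by (simp add: field_simps)
  qed
qed

section \<open>The perturbed recurrence\<close>

text \<open>
  Freezing \<open>a\<close> at its current value splits the recurrence into the scalar quantities \<open>u j\<close>, one for each root,
  and the error of freezing is \<open>o(1/n)\<close>. Any \<open>q\<close> strictly between \<open>1 / 2\<close> and \<open>p\<close> leaves room to absorb this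
  error into the contraction factor \<open>1 - p / n\<close>.
\<close>

lemma perturbed_recurrence_summable:
  fixes \<zeta> :: "'i \<Rightarrow> complex" and a \<beta> r :: "nat \<Rightarrow> complex" and p :: real
  assumes fin: "finite I" and inj: "inj_on \<zeta> I" and unit: "\<And>j. j \<in> I \<Longrightarrow> cmod (\<zeta> j) = 1"
    and ne: "I \<noteq> {}"
    and a: "(\<lambda>n. of_nat n * (1 - a n)) \<longlonglongrightarrow> of_real p" and p: "p > 1 / 2"
    and rec: "\<And>n. n \<ge> card I \<Longrightarrow>
      (\<Sum>k\<le>card I. coeff (recip_root_poly I \<zeta>) k * (a (n - k) ^ k * \<beta> (n - k))) = r n"
    and r: "summable (\<lambda>n. (real n * cmod (r n))\<^sup>2)"
  shows "summable (\<lambda>n. (cmod (\<beta> n))\<^sup>2)"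
proof -
  define J where "J = card I"
  define c where "c = coeff (recip_root_poly I \<zeta>)"
  define P where "P j = recip_root_poly (I - {j}) \<zeta>" for j
  define d where "d j = coeff (P j)" for j
  define u where "u j n = (\<Sum>k<J. d j k * (a n ^ k * \<beta> (n - k)))" for j n
  define U where "U n = (\<Sum>j\<in>I. cmod (u j n))" for n
  define lam where "lam j k = inverse (\<zeta> j) ^ k / poly (P j) (inverse (\<zeta> j))" for j k
  define L where "L = (\<Sum>k<J. \<Sum>j\<in>I. cmod (lam j k))"
  define C where "C = 2 * L"
  \<comment> \<open>The relative error of freezing \<open>a\<close>: the first sum comes from replacing \<open>a (n - k)\<close> by \<open>a n\<close> in the
    recurrence, the second from the change of the coefficients of \<open>u j\<close> between times \<open>n - 1\<close> and \<open>n\<close>.\<close>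
  define E where "E j n = C * ((\<Sum>k<J. cmod (c (Suc k)) * cmod (a n ^ Suc k - a (n - Suc k) ^ Suc k))
      + cmod (a n) * (\<Sum>k<J. cmod (d j k) * cmod (a n ^ k - a (n - 1) ^ k)))" for j n
  have J: "J > 0" using fin ne by (simp add: J_def card_gt_0_iff)
  have U_nonneg: "U n \<ge> 0" for n by (simp add: U_def sum_nonneg)
  have a1: "a \<longlonglongrightarrow> 1" by (rule tendsto_1_of_rate[OF a])
  have \<zeta>0: "\<zeta> j \<noteq> 0" if "j \<in> I" for j using unit[OF that] by auto

  have recover: "a n ^ k * \<beta> (n - k) = (\<Sum>j\<in>I. lam j k * u j n)" if k: "k < J" for n k
  proof -
    have "monom 1 k = (\<Sum>j\<in>I. smult (lam j k) (P j))"
      unfolding lam_def P_def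
      by (rule lagrange_recip_root_poly[OF fin inj]) (use \<zeta>0 k in \<open>auto simp: J_def\<close>)
    from arg_cong[OF this, of "\<lambda>p. coeff p l" for l]
    have delta: "(\<Sum>j\<in>I. lam j k * d j l) = (if k = l then 1 else 0)" for l
      by (simp add: coeff_sum d_def)
    have "(\<Sum>j\<in>I. lam j k * u j n) = (\<Sum>l<J. (\<Sum>j\<in>I. lam j k * d j l) * (a n ^ l * \<beta> (n - l)))"
      unfolding u_def sum_distrib_left sum_distrib_right
      by (subst sum.swap) (simp add: mult_ac)
    also have "\<dots> = (\<Sum>l<J. if k = l then a n ^ l * \<beta> (n - l) else 0)"
      unfolding delta by (intro sum.cong) auto
    also have "\<dots> = a n ^ k * \<beta> (n - k)"
      using k by simp
    finally show ?thesis ..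
  qed

  have "eventually (\<lambda>n. \<forall>k\<in>{..<J}. cmod (a n ^ k) > 1 / 2) sequentially"
  proof (intro eventually_ball_finite ballI)
    fix k
    have "(\<lambda>n. cmod (a n ^ k)) \<longlonglongrightarrow> cmod (1 ^ k)"
      by (intro tendsto_intros a1)
    then show "eventually (\<lambda>n. cmod (a n ^ k) > 1 / 2) sequentially"
      by (rule order_tendstoD) simp
  qed simp
  then have beta_le: "eventually (\<lambda>n. \<forall>k<J. cmod (\<beta> (n - k)) \<le> C * U n) sequentially"
  proof eventually_elim
    case (elim n)
    show ?case
    proof (intro allI impI)
      fix k assume k: "k < J"
      have "1 / 2 * cmod (\<beta> (n - k)) \<le> cmod (a n ^ k) * cmod (\<beta> (n - k))"
        using elim k by (intro mult_right_mono) (auto intro: less_imp_le)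
      also have "\<dots> = cmod (\<Sum>j\<in>I. lam j k * u j n)"
        by (simp only: norm_mult[symmetric] recover[OF k])
      also have "\<dots> \<le> (\<Sum>j\<in>I. cmod (lam j k) * cmod (u j n))"
        by (rule order_trans[OF norm_sum]) (simp add: norm_mult)
      also have "\<dots> \<le> (\<Sum>j\<in>I. L * cmod (u j n))"
      proof (intro sum_mono mult_right_mono)
        fix j assume j: "j \<in> I"
        have "cmod (lam j k) \<le> (\<Sum>j\<in>I. cmod (lam j k))"
          using fin j by (intro member_le_sum) auto
        also have "\<dots> \<le> L"
          unfolding L_def using k by (intro member_le_sum) (auto intro: sum_nonneg)
        finally show "cmod (lam j k) \<le> L" .
      qed simp
      also have "\<dots> = L * U n" by (simp add: U_def sum_distrib_left)
      finally show "cmod (\<beta> (n - k)) \<le> C * U n" by (simp add: C_def)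
    qed
  qed

  have step: "u j (Suc n) = \<zeta> j * a (Suc n) * u j n + r (Suc n)
      + (\<Sum>k<J. c (Suc k) * ((a (Suc n) ^ Suc k - a (n - k) ^ Suc k) * \<beta> (n - k)))
      + \<zeta> j * a (Suc n) * (\<Sum>k<J. d j k * ((a (Suc n) ^ k - a n ^ k) * \<beta> (n - k)))"
    if j: "j \<in> I" and n: "n \<ge> J" for j n
  proof -
    have "degree (P j) < J"
      using degree_recip_root_poly_le[of "I - {j}" \<zeta>] j fin J
      unfolding P_def J_def by (simp add: card_Diff_singleton)
    from sum_coeff_linear_factor_mult[OF this, of "\<zeta> j" "\<lambda>k. a (Suc n) ^ k * \<beta> (Suc n - k)"]
    have 1: "(\<Sum>k\<le>J. c k * (a (Suc n) ^ k * \<beta> (Suc n - k)))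
        = u j (Suc n) - \<zeta> j * (\<Sum>k<J. d j k * (a (Suc n) ^ Suc k * \<beta> (n - k)))"
      unfolding c_def recip_root_poly_remove[OF fin j] P_def[symmetric] d_def[symmetric] u_def
      by simp
    have "(\<Sum>k\<le>J. c k * (a (Suc n) ^ k * \<beta> (Suc n - k))) - r (Suc n)
        = (\<Sum>k\<le>J. c k * ((a (Suc n) ^ k - a (Suc n - k) ^ k) * \<beta> (Suc n - k)))"
      using rec[of "Suc n", folded J_def c_def, symmetric] n
      by (simp add: algebra_simps sum_subtractf)
    also have "\<dots> = (\<Sum>k<J. c (Suc k) * ((a (Suc n) ^ Suc k - a (n - k) ^ Suc k) * \<beta> (n - k)))"
      by (subst sum.atMost_shift) simp
    finally have 2: "(\<Sum>k\<le>J. c k * (a (Suc n) ^ k * \<beta> (Suc n - k))) = r (Suc n)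
        + (\<Sum>k<J. c (Suc k) * ((a (Suc n) ^ Suc k - a (n - k) ^ Suc k) * \<beta> (n - k)))"
      by (simp add: algebra_simps)
    have 3: "\<zeta> j * (\<Sum>k<J. d j k * (a (Suc n) ^ Suc k * \<beta> (n - k)))
        = \<zeta> j * a (Suc n) * u j n
          + \<zeta> j * a (Suc n) * (\<Sum>k<J. d j k * ((a (Suc n) ^ k - a n ^ k) * \<beta> (n - k)))"
      unfolding u_def by (simp add: algebra_simps sum_subtractf sum_distrib_left)
    show ?thesis
      using 1 2 3 by (simp add: algebra_simps)
  qed

  have norm_step: "cmod (u j (Suc n)) \<le> cmod (a (Suc n)) * cmod (u j n) + E j (Suc n) * U n + cmod (r (Suc n))"
    if j: "j \<in> I" and n: "n \<ge> J" and b: "\<forall>k<J. cmod (\<beta> (n - k)) \<le> C * U n" for j n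
  proof -
    have s1: "cmod (\<Sum>k<J. c (Suc k) * ((a (Suc n) ^ Suc k - a (n - k) ^ Suc k) * \<beta> (n - k)))
        \<le> (\<Sum>k<J. cmod (c (Suc k)) * cmod (a (Suc n) ^ Suc k - a (n - k) ^ Suc k)) * (C * U n)"
      unfolding sum_distrib_right mult.assoc
      by (intro sum_norm_le) (use b in \<open>auto simp: norm_mult simp del: power_Suc intro!: mult_left_mono\<close>)
    have s2: "cmod (\<Sum>k<J. d j k * ((a (Suc n) ^ k - a n ^ k) * \<beta> (n - k)))
        \<le> (\<Sum>k<J. cmod (d j k) * cmod (a (Suc n) ^ k - a n ^ k)) * (C * U n)"
      unfolding sum_distrib_right mult.assoc
      by (intro sum_norm_le) (use b in \<open>auto simp: norm_mult intro!: mult_left_mono\<close>)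
    have "cmod (u j (Suc n)) \<le> cmod (a (Suc n)) * cmod (u j n) + cmod (r (Suc n))
      + cmod (\<Sum>k<J. c (Suc k) * ((a (Suc n) ^ Suc k - a (n - k) ^ Suc k) * \<beta> (n - k)))
      + cmod (a (Suc n)) * cmod (\<Sum>k<J. d j k * ((a (Suc n) ^ k - a n ^ k) * \<beta> (n - k)))"
      unfolding step[OF j n]
      by (intro norm_triangle_le add_mono order_refl) (simp_all add: norm_mult unit[OF j])
    also have "\<dots> \<le> cmod (a (Suc n)) * cmod (u j n) + cmod (r (Suc n))
      + (\<Sum>k<J. cmod (c (Suc k)) * cmod (a (Suc n) ^ Suc k - a (n - k) ^ Suc k)) * (C * U n)
      + cmod (a (Suc n)) * ((\<Sum>k<J. cmod (d j k) * cmod (a (Suc n) ^ k - a n ^ k)) * (C * U n))"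
      by (intro add_mono mult_left_mono s1 s2 order_refl) simp
    finally show ?thesis
      by (simp add: E_def algebra_simps)
  qed

  have E0: "(\<lambda>n. real n * (\<Sum>j\<in>I. E j n)) \<longlonglongrightarrow> 0"
  proof -
    have "(\<lambda>n. \<Sum>j\<in>I. C * ((\<Sum>k<J. cmod (c (Suc k)) * (real n * cmod (a n ^ Suc k - a (n - Suc k) ^ Suc k)))
      + cmod (a n) * (\<Sum>k<J. cmod (d j k) * (real n * cmod (a n ^ k - a (n - 1) ^ k)))))
      \<longlonglongrightarrow> (\<Sum>j\<in>I. C * ((\<Sum>k<J. cmod (c (Suc k)) * 0) + cmod 1 * (\<Sum>k<J. cmod (d j k) * 0)))"
      by (intro tendsto_sum tendsto_mult tendsto_add tendsto_const tendsto_norm a1 rate_power_diff[OF a])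
    then show ?thesis
      by (simp add: E_def sum_distrib_left algebra_simps del: power_Suc)
  qed

  obtain q where q: "1 / 2 < q" "q < p" using dense[OF p] by blast
  obtain q' where q': "q < q'" "q' < p" using dense[OF q(2)] by blast
  have "eventually (\<lambda>n. real n * (\<Sum>j\<in>I. E j n) < q' - q) sequentially"
    using E0 by (rule order_tendstoD) (use q' in simp)
  with rate_norm_le[OF a q'(2)] have contr: "eventually (\<lambda>n. cmod (a n) + (\<Sum>j\<in>I. E j n) \<le> 1 - q / real n) sequentially"
    using eventually_gt_at_top[of 0]
  proof eventually_elim
    case (elim n)
    have "(\<Sum>j\<in>I. E j n) \<le> q' / real n - q / real n"
      using elim by (simp add: field_simps)
    with elim show ?case by linarith
  qed
  have "eventually (\<lambda>n. U (Suc n) \<le> (1 - q / Suc n) * U n + (J * (Suc n * cmod (r (Suc n)))) / Suc n) sequentially"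
    using beta_le eventually_ge_at_top[of J] contr[THEN eventually_sequentially_Suc[THEN iffD2]]
  proof eventually_elim
    case (elim n)
    have "U (Suc n) \<le> (\<Sum>j\<in>I. cmod (a (Suc n)) * cmod (u j n) + E j (Suc n) * U n + cmod (r (Suc n)))"
      unfolding U_def[of "Suc n"] by (intro sum_mono norm_step) (use elim in auto)
    also have "\<dots> = cmod (a (Suc n)) * (\<Sum>j\<in>I. cmod (u j n)) + (\<Sum>j\<in>I. E j (Suc n)) * U n + J * cmod (r (Suc n))"
      by (simp add: sum.distrib J_def sum_distrib_left sum_distrib_right)
    also have "\<dots> = (cmod (a (Suc n)) + (\<Sum>j\<in>I. E j (Suc n))) * U n + J * cmod (r (Suc n))"
      by (simp only: U_def distrib_right)
    also have "\<dots> \<le> (1 - q / Suc n) * U n + J * cmod (r (Suc n))"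
      using elim by (intro add_right_mono mult_right_mono U_nonneg) auto
    finally show ?case by simp
  qed
  then have "summable (\<lambda>n. (U n)\<^sup>2)"
  proof (rule contracting_recursion_square_summable[OF q(1) U_nonneg, rotated 2])
    show "summable (\<lambda>n. (real J * (real n * cmod (r n)))\<^sup>2)"
      using summable_mult[OF r, of "(real J)\<^sup>2"] by (simp add: power_mult_distrib)
  qed auto
  moreover have "eventually (\<lambda>n. cmod (\<beta> n) \<le> C * U n) sequentially"
    using beta_le by eventually_elim (use J in force)
  then obtain N where "\<And>n. n \<ge> N \<Longrightarrow> cmod (\<beta> n) \<le> C * U n"
    unfolding eventually_sequentially by blast
  then have "\<bar>cmod (\<beta> n)\<bar> \<le> \<bar>C * U n\<bar>" if "n \<ge> N" for n
    using that by fastforce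
  ultimately show ?thesis
    by (rule summable_square_mono)
qed

section \<open>Rearranging the power series\<close>

text \<open>
  Only finitely many \<open>k\<close> contribute, so collecting powers of \<open>w\<close> is a finite sum of shifted series. With
  \<open>y k n = a n ^ k * \<alpha> n\<close> the first series is \<open>\<Sum>n. \<alpha> n * poly P (a n * w) * w ^ n\<close>; with \<open>y k = c\<close> it is
  \<open>poly P w\<close> times the power series of \<open>c\<close>. Equality of the collected coefficients then identifies the two.
\<close>

lemma sums_poly_rearrange:
  fixes y :: "nat \<Rightarrow> nat \<Rightarrow> complex" and P :: "complex poly"
  assumes y: "\<And>k. (\<lambda>n. y k n * w ^ n) sums s k"
  shows "(\<lambda>n. (\<Sum>k\<le>degree P. coeff P k * w ^ k * y k n) * w ^ n) sums (\<Sum>k\<le>degree P. coeff P k * w ^ k * s k)"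
    and "(\<lambda>m. (\<Sum>k\<le>m. coeff P k * y k (m - k)) * w ^ m) sums (\<Sum>k\<le>degree P. coeff P k * w ^ k * s k)"
proof -
  have "(\<lambda>n. \<Sum>k\<le>degree P. coeff P k * w ^ k * (y k n * w ^ n)) sums (\<Sum>k\<le>degree P. coeff P k * w ^ k * s k)"
    by (intro sums_sum sums_mult y)
  then show "(\<lambda>n. (\<Sum>k\<le>degree P. coeff P k * w ^ k * y k n) * w ^ n) sums (\<Sum>k\<le>degree P. coeff P k * w ^ k * s k)"
    by (simp add: sum_distrib_right mult.assoc)
  have "(\<lambda>m. if k \<le> m then coeff P k * y k (m - k) * w ^ m else 0) sums (coeff P k * w ^ k * s k)" for k
  proof -
    have "(\<lambda>i. (\<lambda>m. if k \<le> m then coeff P k * y k (m - k) * w ^ m else 0) (i + k)) sums (coeff P k * w ^ k * s k)"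
      using sums_mult[OF y[of k], of "coeff P k * w ^ k"] by (simp add: power_add mult_ac)
    then show ?thesis
      by (subst (asm) sums_zero_iff_shift) auto
  qed
  then have "(\<lambda>m. \<Sum>k\<le>degree P. if k \<le> m then coeff P k * y k (m - k) * w ^ m else 0) sums (\<Sum>k\<le>degree P. coeff P k * w ^ k * s k)"
    by (intro sums_sum)
  moreover have "(\<Sum>k\<le>degree P. if k \<le> m then coeff P k * y k (m - k) * w ^ m else 0)
      = (\<Sum>k\<le>m. coeff P k * y k (m - k)) * w ^ m" for m
  proof -
    have "(\<Sum>k\<le>degree P. if k \<le> m then coeff P k * y k (m - k) * w ^ m else 0)
        = (\<Sum>k\<in>{..degree P} \<inter> {..m}. coeff P k * y k (m - k) * w ^ m)"
      by (subst sum.inter_restrict) auto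
    also have "\<dots> = (\<Sum>k\<le>m. coeff P k * y k (m - k) * w ^ m)"
      by (rule sum.mono_neutral_left) (auto simp: coeff_eq_0 not_le)
    finally show ?thesis by (simp add: sum_distrib_right)
  qed
  ultimately show "(\<lambda>m. (\<Sum>k\<le>m. coeff P k * y k (m - k)) * w ^ m) sums (\<Sum>k\<le>degree P. coeff P k * w ^ k * s k)"
    by simp
qed

fun triangular_solution :: "(nat \<Rightarrow> nat \<Rightarrow> complex) \<Rightarrow> (nat \<Rightarrow> complex) \<Rightarrow> nat \<Rightarrow> complex" where
  "triangular_solution t b n = b n - (\<Sum>k\<in>{1..n}. t n k * triangular_solution t b (n - k))"

declare triangular_solution.simps [simp del]

lemma triangular_solution:
  assumes "\<And>n. t n 0 = 1"
  shows "(\<Sum>k\<le>n. t n k * triangular_solution t b (n - k)) = b n"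
proof -
  have "{..n} = insert 0 {1..n}" by auto
  then have "(\<Sum>k\<le>n. t n k * triangular_solution t b (n - k))
      = triangular_solution t b n + (\<Sum>k\<in>{1..n}. t n k * triangular_solution t b (n - k))"
    using assms by simp
  then show ?thesis
    by (simp add: triangular_solution.simps[of t b n])
qed

section \<open>The inclusion\<close>

theorem theorem7:
  fixes J :: nat and z :: "nat \<Rightarrow> complex" and a :: "nat \<Rightarrow> complex" and p :: real
  assumes "J \<ge> 1"
    and "\<And>j. j \<in> {1..J} \<Longrightarrow> cmod (z j) = 1"
    and "inj_on z {1..J}"
    and "\<And>n. a n \<noteq> 1"
    and "(\<lambda>n. of_nat n * (1 - a n)) \<longlonglongrightarrow> of_real p"
    and "p > 1 / 2"
  shows "\<forall>g\<in>hardy_H2. \<exists>h\<in>rk_space (dilated_basis (circle_poly J z) a).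
           \<forall>w\<in>ball 0 1. h w = circle_poly J z w * g w"
proof
  fix g assume "g \<in> hardy_H2"
  then obtain c where c: "summable (\<lambda>n. (cmod (c n))\<^sup>2)"
    and g: "\<And>w. w \<in> ball 0 1 \<Longrightarrow> (\<lambda>n. c n * w ^ n) sums g w"
    using hardy_H2_coeffs by blast
  note a = assms(5)
  define \<zeta> where "\<zeta> j = cnj (z j)" for j
  define \<Phi> where "\<Phi> = recip_root_poly {1..J} \<zeta>"
  define f where "f = dilated_basis (circle_poly J z) a"
  have circle: "circle_poly J z = poly \<Phi>"
    by (auto simp: circle_poly_def \<Phi>_def poly_recip_root_poly \<zeta>_def)
  have deg: "degree \<Phi> \<le> J"
    using degree_recip_root_poly_le[of "{1..J}" \<zeta>] by (simp add: \<Phi>_def)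

  define t where "t n k = coeff \<Phi> k * a (n - k) ^ k" for n k
  define b where "b n = (\<Sum>k\<le>n. coeff \<Phi> k * c (n - k))" for n
  define \<alpha> where "\<alpha> = triangular_solution t b"
  have \<alpha>: "(\<Sum>k\<le>n. coeff \<Phi> k * (a (n - k) ^ k * \<alpha> (n - k))) = (\<Sum>k\<le>n. coeff \<Phi> k * c (n - k))" for n
    using triangular_solution[where t = t and b = b and n = n]
    by (simp add: t_def \<alpha>_def b_def \<Phi>_def coeff_0_recip_root_poly mult.assoc)

  define r where "r n = (\<Sum>k\<le>J. coeff \<Phi> k * ((1 - a (n - k) ^ k) * c (n - k)))" for n
  \<comment> \<open>For \<open>n < J\<close> the truncated subtraction \<open>n - k\<close> would give spurious terms, so the two sums agree only
    from \<open>J\<close> on; square-summability does not see the earlier indices.\<close>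
  have cut: "(\<Sum>k\<le>J. coeff \<Phi> k * y k) = (\<Sum>k\<le>n. coeff \<Phi> k * y k)" if "n \<ge> J" for n y
    using that deg by (intro sum.mono_neutral_left) (auto simp: coeff_eq_0)
  have r: "summable (\<lambda>n. (real n * cmod (r n))\<^sup>2)"
  proof -
    have "summable (\<lambda>n. (cmod (coeff \<Phi> k) * (cmod (of_nat n * (1 - a (n - k) ^ k)) * cmod (c (n - k))))\<^sup>2)" for k
    proof -
      have "Bseq (\<lambda>n. of_nat n * (1 - a (n - k) ^ k))"
        using rate_power_shift[OF a] by (intro convergent_imp_Bseq convergentI)
      then obtain M where M: "M > 0" "\<And>n. cmod (of_nat n * (1 - a (n - k) ^ k)) \<le> M"
        unfolding Bseq_def by blast
      have sh: "summable (\<lambda>n. (cmod (c (n - k)))\<^sup>2)"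
        using c summable_iff_shift[of "\<lambda>n. (cmod (c (n - k)))\<^sup>2" k] by simp
      show ?thesis
      proof (rule summable_square_mono[OF sh, of 0 _ "cmod (coeff \<Phi> k) * M"])
        fix n
        show "\<bar>cmod (coeff \<Phi> k) * (cmod (of_nat n * (1 - a (n - k) ^ k)) * cmod (c (n - k)))\<bar>
            \<le> \<bar>cmod (coeff \<Phi> k) * M * cmod (c (n - k))\<bar>"
          using M by (simp only: abs_mult abs_norm_cancel mult.assoc)
            (intro mult_left_mono mult_right_mono, auto intro: order_trans[OF M(2)])
      qed
    qed
    then have s: "summable (\<lambda>n. (\<Sum>k\<le>J. cmod (coeff \<Phi> k) * (cmod (of_nat n * (1 - a (n - k) ^ k)) * cmod (c (n - k))))\<^sup>2)"
      by (intro summable_square_sum)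
    show ?thesis
    proof (rule summable_square_mono[OF s, of 0 _ 1])
      fix n
      have "real n * cmod (r n) \<le> real n * (\<Sum>k\<le>J. cmod (coeff \<Phi> k * ((1 - a (n - k) ^ k) * c (n - k))))"
        unfolding r_def by (intro mult_left_mono norm_sum) simp
      also have "\<dots> = (\<Sum>k\<le>J. cmod (coeff \<Phi> k) * (cmod (of_nat n * (1 - a (n - k) ^ k)) * cmod (c (n - k))))"
        by (simp add: sum_distrib_left norm_mult mult_ac)
      finally show "\<bar>real n * cmod (r n)\<bar> \<le> \<bar>1 * (\<Sum>k\<le>J. cmod (coeff \<Phi> k) * (cmod (of_nat n * (1 - a (n - k) ^ k)) * cmod (c (n - k))))\<bar>"
        by simp
    qed
  qed

  have \<zeta>_inj: "inj_on \<zeta> {1..J}"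
    using assms(3) unfolding \<zeta>_def inj_on_def complex_cnj_cancel_iff .
  have \<zeta>_unit: "cmod (\<zeta> j) = 1" if "j \<in> {1..J}" for j
    unfolding \<zeta>_def complex_mod_cnj by (rule assms(2)[OF that])
  have diff_rec: "(\<Sum>k\<le>card {1..J}. coeff (recip_root_poly {1..J} \<zeta>) k * (a (n - k) ^ k * (\<alpha> (n - k) - c (n - k)))) = r n"
    if n: "n \<ge> card {1..J}" for n
  proof -
    have nJ: "n \<ge> J" using n by simp
    have "(\<Sum>k\<le>J. coeff \<Phi> k * (a (n - k) ^ k * \<alpha> (n - k))) = (\<Sum>k\<le>J. coeff \<Phi> k * c (n - k))"
      unfolding cut[OF nJ] by (rule \<alpha>)
    then show ?thesis
      unfolding \<Phi>_def[symmetric] r_def card_atLeastAtMost diff_Suc_1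
      by (simp add: right_diff_distrib left_diff_distrib sum_subtractf)
  qed
  have "{1..J} \<noteq> {}" using assms(1) by simp
  from perturbed_recurrence_summable[where \<beta> = "\<lambda>n. \<alpha> n - c n",
      OF finite_atLeastAtMost \<zeta>_inj \<zeta>_unit this a assms(6) diff_rec r]
  have "summable (\<lambda>n. (cmod (\<alpha> n - c n))\<^sup>2)" .
  then have "summable (\<lambda>n. (cmod (\<alpha> n - c n) + cmod (c n))\<^sup>2)"
    using c by (rule summable_square_add)
  then have \<alpha>_l2: "summable (\<lambda>n. (cmod (\<alpha> n))\<^sup>2)"
  proof (rule summable_square_mono[of _ 0 _ 1])
    show "\<bar>cmod (\<alpha> n)\<bar> \<le> \<bar>1 * (cmod (\<alpha> n - c n) + cmod (c n))\<bar>" for n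
      using norm_triangle_ineq[of "\<alpha> n - c n" "c n"] by simp
  qed

  \<comment> \<open>The domain of the kernel may contain points outside the disc, where only the series defines \<open>h\<close>.\<close>
  define h where "h w = (if w \<in> ball 0 1 then poly \<Phi> w * g w else (\<Sum>n. \<alpha> n * f n w))" for w
  have "(\<lambda>n. \<alpha> n * f n w) sums h w" if w: "w \<in> rk_domain f" for w
  proof -
    have "summable (\<lambda>n. \<alpha> n * f n w)"
      using w \<alpha>_l2 by (intro summable_mult_of_summable_squares) (auto simp: rk_domain_def)
    moreover have "(\<Sum>n. \<alpha> n * f n w) = poly \<Phi> w * g w" if w1: "w \<in> ball 0 1"
    proof -
      have "summable (\<lambda>n. (a n ^ k * \<alpha> n) * w ^ n)" for k
      proof -
        have "(\<lambda>n. sqrt ((cmod (\<alpha> n))\<^sup>2)) \<longlonglongrightarrow> sqrt 0"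
          using summable_LIMSEQ_zero[OF \<alpha>_l2] by (rule tendsto_real_sqrt)
        then have "\<alpha> \<longlonglongrightarrow> 0" by (simp add: tendsto_norm_zero_iff)
        then have "(\<lambda>n. a n ^ k * \<alpha> n) \<longlonglongrightarrow> 1 ^ k * 0"
          by (intro tendsto_intros tendsto_1_of_rate[OF a])
        then have "Bseq (\<lambda>n. a n ^ k * \<alpha> n)"
          by (intro convergent_imp_Bseq convergentI)
        then obtain A where A: "\<And>n. cmod (a n ^ k * \<alpha> n) \<le> A" unfolding Bseq_def by blast
        show ?thesis
        proof (rule summable_comparison_test')
          show "summable (\<lambda>n. A * cmod w ^ n)"
            using w1 by (intro summable_mult summable_geometric) simp
          show "norm (a n ^ k * \<alpha> n * w ^ n) \<le> A * cmod w ^ n" if "n \<ge> 0" for n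
            unfolding norm_mult[of _ "w ^ n"] norm_power[of w] by (intro mult_right_mono A) simp
        qed
      qed
      then have s: "(\<lambda>n. (a n ^ k * \<alpha> n) * w ^ n) sums (\<Sum>n. (a n ^ k * \<alpha> n) * w ^ n)" for k
        by (rule summable_sums)
      have "(\<lambda>n. (\<Sum>k\<le>degree \<Phi>. coeff \<Phi> k * w ^ k * (a n ^ k * \<alpha> n)) * w ^ n) = (\<lambda>n. \<alpha> n * f n w)"
        by (simp add: f_def dilated_basis_def circle poly_altdef sum_distrib_left sum_distrib_right
            power_mult_distrib mult_ac)
      note lhs = sums_poly_rearrange[of "\<lambda>k n. a n ^ k * \<alpha> n" w, OF s, of \<Phi>, unfolded this \<alpha>]
      have "(\<lambda>n. (\<Sum>k\<le>degree \<Phi>. coeff \<Phi> k * w ^ k * c n) * w ^ n) = (\<lambda>n. poly \<Phi> w * (c n * w ^ n))"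
        by (simp only: poly_altdef sum_distrib_right mult.assoc)
      note rhs = sums_poly_rearrange[of "\<lambda>_. c" w "\<lambda>_. g w", OF g[OF w1], of \<Phi>, unfolded this]
      have "(\<Sum>n. \<alpha> n * f n w) = (\<Sum>n. poly \<Phi> w * (c n * w ^ n))"
        using sums_unique[OF lhs(1)] sums_unique[OF rhs(1)] sums_unique2[OF lhs(2) rhs(2)] by simp
      also have "\<dots> = poly \<Phi> w * g w"
        using sums_mult[OF g[OF w1], of "poly \<Phi> w"] by (simp add: sums_iff)
      finally show ?thesis .
    qed
    ultimately show ?thesis
      by (auto simp: h_def sums_iff)
  qed
  with \<alpha>_l2 have "h \<in> rk_space f"
    unfolding rk_space_def by blast
  then show "\<exists>h\<in>rk_space (dilated_basis (circle_poly J z) a). \<forall>w\<in>ball 0 1. h w = circle_poly J z w * g w"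
    unfolding f_def by (rule bexI[rotated]) (simp add: h_def circle)
qed

end
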